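(* For each $r \in \mathbb{Q} \cap (0,1)$ with $\mathsf{n}(r) \neq 1$, the additive monoid $S_r := \langle r^n \mid n \in \mathbb{N}_0 \rangle$ is an atomic monoid that does not satisfy the ACCP.
   Context: $\mathbb{N}_0 = \{0,1,2,\dots\}$. For $S \subseteq \mathbb{Q}_{\ge 0}$, $\langle S \rangle$ denotes the additive submonoid of $\mathbb{Q}_{\ge 0}$ generated by $S$. For $r \in \mathbb{Q}_{>0}$, $\mathsf{n}(r)$ is the numerator of $r$ in lowest terms. For an additive submonoid $M$ of $\mathbb{Q}_{\ge 0}$, an element $a \in M\setminus\{0\}$ is an atom if $a = x+y$ with $x,y \in M$ implies $x=0$ or $y=0$; $M$ is atomic if each nonzero element is a (finite) sum of atoms. A principal ideal of $M$ is a subset of the form $x + M$ with $x \in M$; $M$ satisfies the ACCP (ascending chain condition on principal ideals) if every increasing (under inclusion) sequence of principal ideals of $M$ eventually stabilizes. *)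

theory Defs
  imports Complex_Main "HOL-Library.Multiset"
begin

definition rat_submonoid :: "rat set \<Rightarrow> bool" where
  "rat_submonoid M \<longleftrightarrow> M \<subseteq> {0..} \<and> 0 \<in> M \<and> (\<forall>x\<in>M. \<forall>y\<in>M. x + y \<in> M)"

text \<open>The least submonoid of the nonnegative rationals containing \<open>S\<close>. Only meaningful
  for \<open>S \<subseteq> {0..}\<close>; otherwise the intersection is over the empty family and gives \<open>UNIV\<close>.\<close>

definition generated_monoid :: "rat set \<Rightarrow> rat set" where
  "generated_monoid S = rat_submonoid hull S"

definition atoms :: "rat set \<Rightarrow> rat set" where
  "atoms M = {a \<in> M - {0}. \<forall>x\<in>M. \<forall>y\<in>M. a = x + y \<longrightarrow> x = 0 \<or> y = 0}"

definition atomic_monoid :: "rat set \<Rightarrow> bool" where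
  "atomic_monoid M \<longleftrightarrow> (\<forall>x\<in>M - {0}. \<exists>A. set_mset A \<subseteq> atoms M \<and> x = \<Sum>\<^sub># A)"

definition principal_ideals :: "rat set \<Rightarrow> rat set set" where
  "principal_ideals M = {(+) x ` M | x. x \<in> M}"

definition ACCP :: "rat set \<Rightarrow> bool" where
  "ACCP M \<longleftrightarrow> (\<forall>I :: nat \<Rightarrow> rat set.
     range I \<subseteq> principal_ideals M \<and> incseq I \<longrightarrow> (\<exists>N. \<forall>n\<ge>N. I n = I N))"

text \<open>\<open>quotient_of\<close> yields the fraction in lowest terms with positive denominator.\<close>

definition numerator :: "rat \<Rightarrow> int" where
  "numerator r = fst (quotient_of r)"

end

theory Submission
  imports Defs
begin

text \<open>Write \<open>r = a / b\<close> in lowest terms, so \<open>1 < a < b\<close>. Every power \<open>r ^ n\<close> is an atom: in a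
  nontrivial decomposition only powers \<open>r ^ i\<close> with \<open>i > n\<close> can occur, and clearing denominators
  in \<open>1 = (\<Sum>i\<ge>1. c i * r ^ i)\<close> yields \<open>a dvd b ^ K\<close>. On the other hand
  \<open>a * r ^ n = b * r ^ (n + 1) = a * r ^ (n + 1) + (b - a) * r ^ (n + 1)\<close>, so the principal ideals
  of the elements \<open>a * r ^ n\<close> form a strictly ascending chain.\<close>

lemma rat_submonoid_generated:
  assumes "G \<subseteq> {0..}"
  shows "rat_submonoid (generated_monoid G)"
proof -
  \<comment> \<open>This makes the family intersected by the hull nonempty, so the result stays
    inside \<open>{0..}\<close> instead of being \<open>UNIV\<close>.\<close>
  have "rat_submonoid {0..}"
    by (auto simp: rat_submonoid_def)
  then show ?thesis
    using assms unfolding generated_monoid_def hull_def rat_submonoid_def by blast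
qed

lemma generated_monoid_superset: "G \<subseteq> generated_monoid G"
  unfolding generated_monoid_def by (rule hull_subset)

lemma sum_mset_in_submonoid:
  assumes "rat_submonoid M" and "set_mset A \<subseteq> M"
  shows "\<Sum>\<^sub># A \<in> M"
  using assms(2) by (induction A) (use assms(1) in \<open>auto simp: rat_submonoid_def\<close>)

lemma sum_mset_nonneg_rat:
  assumes "set_mset A \<subseteq> {0..}"
  shows "0 \<le> (\<Sum>\<^sub># A :: rat)"
  using assms by (induction A) auto

lemma of_nat_mult_in_submonoid:
  assumes "rat_submonoid M" and "x \<in> M"
  shows "of_nat n * x \<in> M"
  using sum_mset_in_submonoid[of M "replicate_mset n x"] assms by auto

lemma generated_monoid_eq:
  assumes "G \<subseteq> {0..}"
  shows "generated_monoid G = {\<Sum>\<^sub># A | A. set_mset A \<subseteq> G}"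
proof
  have "rat_submonoid {\<Sum>\<^sub># A | A. set_mset A \<subseteq> G}" (is "rat_submonoid ?T")
    unfolding rat_submonoid_def
  proof (intro conjI ballI)
    show "?T \<subseteq> {0..}"
      using assms by (auto intro!: sum_mset_nonneg_rat)
    show "0 \<in> ?T"
      by (auto intro!: exI[of _ "{#}"])
    fix x y assume "x \<in> ?T" and "y \<in> ?T"
    then obtain A B where "x = \<Sum>\<^sub># A" "set_mset A \<subseteq> G" "y = \<Sum>\<^sub># B" "set_mset B \<subseteq> G"
      by blast
    then show "x + y \<in> ?T"
      by (auto intro!: exI[of _ "A + B"])
  qed
  moreover have "G \<subseteq> ?T"
    by (auto intro!: exI[of _ "{#_#}"])
  ultimately show "generated_monoid G \<subseteq> ?T"
    unfolding generated_monoid_def by (intro hull_minimal)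
  show "?T \<subseteq> generated_monoid G"
    using sum_mset_in_submonoid[OF rat_submonoid_generated[OF assms]]
      generated_monoid_superset[of G] by blast
qed

text \<open>A representation as a sum over generators is already a factorization into atoms.\<close>

lemma atomic_generated_monoid:
  assumes "G \<subseteq> {0..}" and "G \<subseteq> atoms (generated_monoid G)"
  shows "atomic_monoid (generated_monoid G)"
  unfolding atomic_monoid_def
proof
  fix x assume "x \<in> generated_monoid G - {0}"
  then obtain A where "set_mset A \<subseteq> G" "x = \<Sum>\<^sub># A"
    using generated_monoid_eq[OF assms(1)] by auto
  then show "\<exists>A. set_mset A \<subseteq> atoms (generated_monoid G) \<and> x = \<Sum>\<^sub># A"
    using assms(2) by blast
qed

text \<open>The differences give \<open>x n\<close> in \<open>x (Suc n) + M\<close>, so the ideals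
  increase. They never stabilize, since \<open>M\<close> has no negative elements and
  \<open>x\<close> strictly decreases.\<close>

lemma not_ACCP_descending:
  assumes M: "rat_submonoid M"
    and x: "\<And>n. x n \<in> M" and diff: "\<And>n. x n - x (Suc n) \<in> M - {0}"
  shows "\<not> ACCP M"
proof
  assume accp: "ACCP M"
  let ?I = "\<lambda>n. (+) (x n) ` M"
  have "?I n \<subseteq> ?I (Suc n)" for n
  proof
    fix z assume "z \<in> ?I n"
    then obtain m where "m \<in> M" "z = x n + m"
      by blast
    then have "(x n - x (Suc n)) + m \<in> M" "z = x (Suc n) + ((x n - x (Suc n)) + m)"
      using M diff[of n] by (auto simp: rat_submonoid_def)
    then show "z \<in> ?I (Suc n)"
      by blast
  qed
  then have "incseq ?I"
    by (rule incseq_SucI)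
  moreover have "range ?I \<subseteq> principal_ideals M"
    using x by (auto simp: principal_ideals_def)
  ultimately obtain N where N: "\<And>n. n \<ge> N \<Longrightarrow> ?I n = ?I N"
    using accp unfolding ACCP_def by blast
  \<comment> \<open>The generator of the next ideal is the element that witnesses
    strictness.\<close>
  have "x (Suc N) + 0 \<in> ?I (Suc N)"
    using M unfolding rat_submonoid_def by blast
  then have "x (Suc N) + 0 \<in> ?I N"
    using N[of "Suc N"] by simp
  then obtain m where "m \<in> M" "x (Suc N) = x N + m"
    by auto
  moreover have "0 \<le> m" "0 < x N - x (Suc N)"
    using M diff[of N] \<open>m \<in> M\<close> by (force simp: rat_submonoid_def)+
  ultimately show False
    by simp
qed

text \<open>Multiplying \<open>r ^ (n + Suc j)\<close> by \<open>b ^ Suc j\<close> leaves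
  \<open>a ^ Suc j * r ^ n\<close>, so every term keeps a factor \<open>a\<close>; finiteness of
  \<open>A\<close> allows one common exponent \<open>K\<close>.\<close>

lemma sum_mset_higher_powers_numerator:
  fixes a b :: int
  assumes r: "r = of_int a / of_int b" and b: "b \<noteq> 0"
    and A: "set_mset A \<subseteq> {r ^ i | i. i > n}"
  shows "\<exists>K m. of_int (b ^ K) * \<Sum>\<^sub># A = of_int (a * m) * (r :: rat) ^ n"
  using A
proof (induction A)
  case empty
  show ?case
    by (auto intro!: exI[of _ 0])
next
  case (add x A)
  then obtain K m where IH: "of_int (b ^ K) * \<Sum>\<^sub># A = of_int (a * m) * r ^ n"
    by auto
  from add.prems obtain i where "x = r ^ i" "i > n"
    by auto
  \<comment> \<open>Here \<open>j = i - n - 1\<close>; the \<open>Suc\<close> is what later supplies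
    the factor \<open>a\<close>.\<close>
  then obtain j where x: "x = r ^ Suc j * r ^ n"
    by (metis less_imp_Suc_add add_Suc_right add.commute power_add)
  have br: "of_int b * r = of_int a"
    using r b by simp
  \<comment> \<open>Adding the exponents clears the denominators of both the new term and the old
    sum, with no need for a maximum.\<close>
  have "of_int (b ^ (K + Suc j)) * \<Sum>\<^sub># (add_mset x A) =
      of_int (b ^ K) * (of_int b * r) ^ Suc j * r ^ n
        + of_int (b ^ Suc j) * (of_int (b ^ K) * \<Sum>\<^sub># A)"
    by (simp add: x power_add power_mult_distrib algebra_simps)
  also have "\<dots> = of_int (a * (b ^ K * a ^ j + b ^ Suc j * m)) * r ^ n"
    unfolding IH br by (simp add: algebra_simps)
  finally show ?case
    by blast
qed

lemma powers_are_atoms: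
  fixes a b :: int
  assumes r: "r = of_int a / of_int b" and ab: "coprime a b" "1 < a" "a < b"
  shows "{r ^ n | n :: nat. True} \<subseteq> atoms (generated_monoid {r ^ n | n. True})"
proof
  let ?G = "{r ^ n | n :: nat. True}"
  have r01: "0 < r" "r < 1"
    using r ab by auto
  have G: "?G \<subseteq> {0..}"
    using r01 by auto
  fix p assume p: "p \<in> ?G"
  then obtain n where n: "p = r ^ n"
    by blast
  have "x = 0 \<or> y = 0"
    if x: "x \<in> generated_monoid ?G" and y: "y \<in> generated_monoid ?G" and sum: "p = x + y" for x y
  proof (rule ccontr)
    assume nz: "\<not> (x = 0 \<or> y = 0)"
    obtain A where A: "set_mset A \<subseteq> ?G" "x = \<Sum>\<^sub># A"
      using x unfolding generated_monoid_eq[OF G] by blast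
    obtain B where B: "set_mset B \<subseteq> ?G" "y = \<Sum>\<^sub># B"
      using y unfolding generated_monoid_eq[OF G] by blast
    have "0 \<le> x" "0 \<le> y"
      using x y rat_submonoid_generated[OF G] by (auto simp: rat_submonoid_def)
    then have less: "x < r ^ n" "y < r ^ n"
      using nz sum n by auto
    \<comment> \<open>Summands are nonnegative, so each is at most the total and hence below
      \<open>r ^ n\<close>; powers of \<open>r\<close> decrease, which forces a larger
      exponent.\<close>
    have higher: "set_mset C \<subseteq> {r ^ i | i. i > n}"
      if C: "set_mset C \<subseteq> ?G" and "\<Sum>\<^sub># C < r ^ n" for C
    proof
      fix c assume c: "c \<in># C"
      then obtain i where i: "c = r ^ i"
        using C by blast
      obtain D where D: "C = add_mset c D"
        using c by (meson mset_add)
      have "0 \<le> \<Sum>\<^sub># D"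
        using C D G by (intro sum_mset_nonneg_rat) auto
      then have "r ^ i < r ^ n"
        using D i \<open>\<Sum>\<^sub># C < r ^ n\<close> by simp
      then have "i > n"
        using power_decreasing[of i n r] r01 by (meson linorder_not_le order_less_imp_le)
      then show "c \<in> {r ^ i | i. i > n}"
        using i by blast
    qed
    \<comment> \<open>The two factorizations are merged because their joint sum is exactly
      \<open>r ^ n\<close>, which then cancels.\<close>
    have "set_mset (A + B) \<subseteq> {r ^ i | i. i > n}"
      using higher[OF A(1)] higher[OF B(1)] A(2) B(2) less by (simp only: set_mset_union Un_least)
    moreover have "b \<noteq> 0"
      using ab by simp
    ultimately obtain K m where "of_int (b ^ K) * \<Sum>\<^sub># (A + B) = of_int (a * m) * r ^ n"
      using sum_mset_higher_powers_numerator[OF r] by blast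
    moreover have "\<Sum>\<^sub># (A + B) = r ^ n"
      using A B sum n by simp
    ultimately have "(of_int (b ^ K) :: rat) = of_int (a * m)"
      using r01 by simp
    then have "b ^ K = a * m"
      by (simp only: of_int_eq_iff)
    then have "a dvd b ^ K"
      by simp
    moreover have "coprime a (b ^ K)"
      using ab(1) by simp
    ultimately have "is_unit a"
      by (metis coprime_common_divisor dvd_refl)
    then show False
      using ab by simp
  qed
  moreover have "p \<in> generated_monoid ?G - {0}"
    using p n r01 generated_monoid_superset[of ?G] by auto
  ultimately show "p \<in> atoms (generated_monoid ?G)"
    unfolding atoms_def by blast
qed

lemma powers_not_ACCP:
  fixes a b :: int
  assumes r: "r = of_int a / of_int b" and ab: "0 < a" "a < b"
  shows "\<not> ACCP (generated_monoid {r ^ n | n :: nat. True})" (is "\<not> ACCP ?S")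
proof (rule not_ACCP_descending)
  have r01: "0 < r"
    using r ab by auto
  then show S: "rat_submonoid ?S"
    by (intro rat_submonoid_generated) auto
  \<comment> \<open>Used with \<open>k = a\<close> for the sequence and with
    \<open>k = b - a\<close> for its differences.\<close>
  have mult: "of_int k * r ^ n \<in> ?S" if "k \<ge> 0" for k n
  proof -
    have "r ^ n \<in> ?S"
      by (rule subsetD[OF generated_monoid_superset]) blast
    then have "of_nat (nat k) * r ^ n \<in> ?S"
      by (rule of_nat_mult_in_submonoid[OF S])
    then show ?thesis
      using that by simp
  qed
  show "of_int a * r ^ n \<in> ?S" for n
    using mult ab by simp
  show "of_int a * r ^ n - of_int a * r ^ Suc n \<in> ?S - {0}" for n
  proof -
    have "of_int a = of_int b * r"
      using r ab by simp
    then have "of_int a * r ^ n - of_int a * r ^ Suc n = of_int b * r * r ^ n - of_int a * r ^ Suc n"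
      by (simp only:)
    also have "\<dots> = of_int (b - a) * r ^ Suc n"
      by (simp add: algebra_simps)
    finally have "of_int a * r ^ n - of_int a * r ^ Suc n = of_int (b - a) * r ^ Suc n" .
    moreover have "of_int (b - a) * r ^ Suc n \<noteq> 0"
      using r01 ab by simp
    ultimately show ?thesis
      using mult[of "b - a" "Suc n"] ab by simp
  qed
qed

theorem corollary4p4:
  fixes r :: rat
  assumes "0 < r" and "r < 1" and "numerator r \<noteq> 1"
  defines "S \<equiv> generated_monoid {r ^ n | n :: nat. True}"
  shows "rat_submonoid S \<and> atomic_monoid S \<and> \<not> ACCP S"
proof -
  obtain a b where q: "quotient_of r = (a, b)"
    by fastforce
  have r: "r = of_int a / of_int b" and b: "b > 0" and co: "coprime a b"
    using quotient_of_div[OF q] quotient_of_denom_pos[OF q] quotient_of_coprime[OF q] by auto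
  have "a \<noteq> 1"
    using assms(3) q by (simp add: numerator_def)
  \<comment> \<open>Positivity of \<open>r\<close> gives \<open>a > 0\<close>, which with
    \<open>a \<noteq> 1\<close> yields \<open>1 < a\<close>; \<open>r < 1\<close> gives
    \<open>a < b\<close>.\<close>
  then have ab: "1 < a" "a < b"
    using assms(1,2) b by (auto simp: r zero_less_divide_iff)
  have G: "{r ^ n | n :: nat. True} \<subseteq> {0..}"
    using assms(1) by auto
  show ?thesis
    unfolding S_def
    using rat_submonoid_generated[OF G] atomic_generated_monoid[OF G powers_are_atoms[OF r co ab]]
      powers_not_ACCP[OF r] ab by simp
qed

end
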